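(* For $i=1,2$ let $\mathcal{H}_i$ be a complex Hilbert space with an orthonormal basis $\{\mathbf{e}_{j,i}\}_{j\in\mathbb{N}}$, and for each $n\in\mathbb{N}$ let $P_{n,i}$ be the orthogonal projection of $\mathcal{H}_i$ onto $\mathrm{span}(\mathbf{e}_{1,i},\ldots,\mathbf{e}_{n,i})$. For $i=1,2$ let $\Sigma_i$ be a linear subspace of $B(\mathcal{H}_i)$, endowed with a norm $\|\cdot\|_i$ for which there is a constant $K_i>0$ with $\|g\|\le K_i\|g\|_i$ for all $g\in\Sigma_i$ (where $\|g\|$ is the operator norm), such that $\Sigma_i$ is closed with respect to the norm $\|\cdot\|_i$ (i.e. $(\Sigma_i,\|\cdot\|_i)$ is a Banach space), $\Sigma_i$ is closed under the adjoint operation $g\mapsto g^*$, and $\Sigma_i$ contains all finite range (finite rank) operators in $B(\mathcal{H}_i)$. Let $\mu:\Sigma_1\to\Sigma_2$ be a bounded linear operator such that for each $g\in\Sigma_1$ the sequence $\mu(P_{n,1}gP_{n,1})$, $n\in\mathbb{N}$, converges in the weak operator topology to $\mu(g)$. Then $\mu$ is completely positive if and only if for each $n\in\mathbb{N}$ the matrix $$L_n(\mu):=[P_{n,2}\,\mu(\mathbf{e}_{i,1}\mathbf{e}_{j,1}^\vee)\,P_{n,2}]_{i,j=1}^n\in B(\mathcal{H}_2)^{(n)}$$ is positive.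
   Context: For a Hilbert space $\mathcal{H}$ with inner product $\langle\cdot,\cdot\rangle$ (linear in the first argument), $B(\mathcal{H})$ is the space of bounded linear operators on $\mathcal{H}$. For $\mathbf{u},\mathbf{v}\in\mathcal{H}$, $\mathbf{u}\mathbf{v}^\vee\in B(\mathcal{H})$ is the rank one operator $\mathbf{u}\mathbf{v}^\vee(\mathbf{x})=\langle\mathbf{x},\mathbf{v}\rangle\mathbf{u}$. A sequence $a_n\in B(\mathcal{H})$ converges in the weak operator topology to $a$ if $\langle a_n\mathbf{x},\mathbf{y}\rangle\to\langle a\mathbf{x},\mathbf{y}\rangle$ for all $\mathbf{x},\mathbf{y}\in\mathcal{H}$. $B(\mathcal{H})^{(n)}$ is the space of $n\times n$ matrices $G=[g_{ij}]_{i,j=1}^n$ with entries $g_{ij}\in B(\mathcal{H})$; its adjoint is $(G^* )_{ij}=g_{ji}^*$, and $G$ is selfadjoint if $G=G^*$. $G$ is positive, written $G\ge 0$, if $G$ is selfadjoint and $\sum_{i,j=1}^n\langle g_{ij}\mathbf{x}_j,\mathbf{x}_i\rangle\ge 0$ for all $\mathbf{x}_1,\ldots,\mathbf{x}_n\in\mathcal{H}$. A bounded linear map $\mu:\Sigma_1\to\Sigma_2$ is completely positive if (i) $\mu(g)^*=\mu(g^* )$ for all $g\in\Sigma_1$, and (ii) for each $n\in\mathbb{N}$ and each matrix $G=[g_{ij}]_{i,j=1}^n\ge 0$ with entries $g_{ij}\in\Sigma_1$, the matrix $[\mu(g_{ij})]_{i,j=1}^n$ is positive. *)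

theory Defs
  imports "HOL-Analysis.Analysis" "HOL-Library.Nonpos_Ints"
begin

section \<open>Complex Hilbert spaces\<close>

class complex_vector = real_vector +
  fixes scaleC :: "complex \<Rightarrow> 'a \<Rightarrow> 'a" (infixr \<open>*\<^sub>C\<close> 75)
  assumes scaleC_add_right: "c *\<^sub>C (x + y) = c *\<^sub>C x + c *\<^sub>C y"
    and scaleC_add_left: "(c + d) *\<^sub>C x = c *\<^sub>C x + d *\<^sub>C x"
    and scaleC_scaleC: "c *\<^sub>C d *\<^sub>C x = (c * d) *\<^sub>C x"
    and scaleC_one: "1 *\<^sub>C x = x"
    and scaleR_scaleC: "r *\<^sub>R x = complex_of_real r *\<^sub>C x"

class complex_normed_vector = complex_vector + real_normed_vector +
  assumes norm_scaleC: "norm (c *\<^sub>C x) = cmod c * norm x"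

(* The inner product is linear in its first argument. *)
class complex_inner = complex_normed_vector +
  fixes cinner :: "'a \<Rightarrow> 'a \<Rightarrow> complex"
  assumes cinner_add_left: "cinner (x + y) z = cinner x z + cinner y z"
    and cinner_scaleC_left: "cinner (c *\<^sub>C x) y = c * cinner x y"
    and cinner_commute: "cinner x y = cnj (cinner y x)"
    and cinner_self: "cinner x x = complex_of_real ((norm x)\<^sup>2)"

class complex_hilbert = complex_inner + banach

global_interpretation complex_vector: vector_space "scaleC :: complex \<Rightarrow> 'a \<Rightarrow> 'a::complex_vector"
  defines csubspace = complex_vector.subspace
    and cspan = complex_vector.span
  by standard (simp_all add: scaleC_add_right scaleC_add_left scaleC_scaleC scaleC_one)

lemma cinner_add_right: "cinner x (y + z) = cinner x y + cinner x (z::'a::complex_inner)"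
  by (metis cinner_add_left cinner_commute complex_cnj_add)

lemma cinner_scaleC_right: "cinner x (c *\<^sub>C y) = cnj c * cinner x (y::'a::complex_inner)"
  by (metis cinner_commute cinner_scaleC_left complex_cnj_mult)

lemma cinner_diff_left: "cinner (x - y) z = cinner x z - cinner y (z::'a::complex_inner)"
  by (metis add_diff_cancel_right' cinner_add_left diff_add_cancel)

lemma cinner_diff_right: "cinner x (y - z) = cinner x y - cinner x (z::'a::complex_inner)"
  by (metis add_diff_cancel_right' cinner_add_right diff_add_cancel)

lemma cinner_zero_right: "cinner x 0 = (0::complex)" for x :: "'a::complex_inner"
  by (metis cinner_diff_right diff_self)

lemma cmod_cinner_le: "cmod (cinner x y) \<le> norm x * norm (y::'a::complex_inner)"
proof (cases "y = 0")
  case True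
  then show ?thesis by (simp add: cinner_zero_right)
next
  case False
  define n where "n = (norm y)\<^sup>2"
  define t where "t = cinner x y / of_real n"
  have n: "n > 0" using False by (simp add: n_def)
  have yx: "cinner y x = cnj (cinner x y)" by (rule cinner_commute)
  have "cinner (x - t *\<^sub>C y) (x - t *\<^sub>C y)
      = cinner x x - cnj t * cinner x y - t * (cinner y x - cnj t * cinner y y)"
    by (simp add: cinner_diff_left cinner_diff_right cinner_scaleC_left cinner_scaleC_right algebra_simps)
  also have "\<dots> = cinner x x - cinner x y * cnj (cinner x y) / of_real n"
    using n by (simp add: t_def yx cinner_self[of y] n_def[symmetric])
  also have "\<dots> = of_real ((norm x)\<^sup>2 - (cmod (cinner x y))\<^sup>2 / n)"
    by (simp add: cinner_self complex_norm_square del: of_real_power)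
  finally have "(norm (x - t *\<^sub>C y))\<^sup>2 = (norm x)\<^sup>2 - (cmod (cinner x y))\<^sup>2 / n"
    unfolding cinner_self of_real_eq_iff .
  then have "(cmod (cinner x y))\<^sup>2 / n \<le> (norm x)\<^sup>2"
    by (metis diff_ge_0_iff_ge zero_le_power2)
  then have "(cmod (cinner x y))\<^sup>2 \<le> (norm x * norm y)\<^sup>2"
    using n by (simp add: n_def field_simps power_mult_distrib)
  then show ?thesis
    by (rule power2_le_imp_le) simp
qed

definition orthonormal_basis :: "(nat \<Rightarrow> 'a::complex_hilbert) \<Rightarrow> bool" where
  "orthonormal_basis e \<longleftrightarrow>
     (\<forall>i j. cinner (e i) (e j) = (if i = j then 1 else 0)) \<and>
     closure (cspan (range e)) = UNIV"


section \<open>Bounded linear operators\<close>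

(* The type of bounded real-linear maps carries the complex structure of pointwise
   scalar multiplication; B(H) is its complex subspace of complex-linear maps.  The
   type's norm is the operator norm. *)

instantiation blinfun :: (real_normed_vector, complex_normed_vector) complex_vector
begin

lift_definition scaleC_blinfun :: "complex \<Rightarrow> 'a \<Rightarrow>\<^sub>L 'b \<Rightarrow> 'a \<Rightarrow>\<^sub>L 'b" is "\<lambda>c f x. c *\<^sub>C f x"
proof -
  fix c :: complex and f :: "'a \<Rightarrow> 'b"
  assume f: "bounded_linear f"
  have comm: "c *\<^sub>C r *\<^sub>R y = r *\<^sub>R c *\<^sub>C y" for r :: real and y :: 'b
    by (simp add: scaleR_scaleC scaleC_scaleC mult.commute)
  have "bounded_linear (\<lambda>y::'b. c *\<^sub>C y)"
    by (rule bounded_linear_intro[where K = "cmod c"])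
       (simp_all add: scaleC_add_right comm norm_scaleC mult.commute)
  then show "bounded_linear (\<lambda>x. c *\<^sub>C f x)"
    using f by (rule bounded_linear_compose)
qed

instance
  by standard
     (transfer, simp add: scaleC_add_right scaleC_add_left scaleC_scaleC scaleC_one scaleR_scaleC)+

end

definition bounded_ops :: "('a::complex_hilbert \<Rightarrow>\<^sub>L 'a) set" where
  "bounded_ops = {a :: 'a \<Rightarrow>\<^sub>L 'a. \<forall>c x. a (c *\<^sub>C x) = c *\<^sub>C a x}"

(* Meaningful for a in bounded_ops; the adjoint is then unique among all bounded
   real-linear maps and is itself complex-linear. *)
definition cadjoint :: "('a::complex_hilbert \<Rightarrow>\<^sub>L 'a) \<Rightarrow> 'a \<Rightarrow>\<^sub>L 'a" where
  "cadjoint a = (THE b :: 'a \<Rightarrow>\<^sub>L 'a. \<forall>x y. cinner (a x) y = cinner x (b y))"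

lift_definition rank_one :: "'a::complex_hilbert \<Rightarrow> 'a \<Rightarrow> 'a \<Rightarrow>\<^sub>L 'a" is
  "\<lambda>u v x. cinner x v *\<^sub>C u"
proof -
  fix u v :: 'a
  show "bounded_linear (\<lambda>x. cinner x v *\<^sub>C u)"
  proof (rule bounded_linear_intro[where K = "norm v * norm u"])
    show "norm (cinner x v *\<^sub>C u) \<le> norm x * (norm v * norm u)" for x
      using mult_right_mono[OF cmod_cinner_le[of x v] norm_ge_zero[of u]]
      by (simp add: norm_scaleC mult.assoc)
  qed (simp_all add: cinner_add_left scaleC_add_left scaleR_scaleC cinner_scaleC_left scaleC_scaleC)
qed

(* The orthogonal projection onto a closed subspace M. *)
definition orth_proj :: "'a::complex_hilbert set \<Rightarrow> 'a \<Rightarrow>\<^sub>L 'a" where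
  "orth_proj M = (THE p :: 'a \<Rightarrow>\<^sub>L 'a. \<forall>x. p x \<in> M \<and> (\<forall>y\<in>M. cinner (x - p x) y = 0))"

(* Bases and matrices are indexed from 0, so this is the projection onto the span
   of the first n basis vectors. *)
definition basis_proj :: "(nat \<Rightarrow> 'a::complex_hilbert) \<Rightarrow> nat \<Rightarrow> 'a \<Rightarrow>\<^sub>L 'a" where
  "basis_proj e n = orth_proj (cspan (e ` {..<n}))"

definition finite_rank :: "('a::complex_hilbert \<Rightarrow>\<^sub>L 'a) \<Rightarrow> bool" where
  "finite_rank a \<longleftrightarrow> (\<exists>F. finite F \<and> range a \<subseteq> cspan F)"

definition wot_tendsto :: "(nat \<Rightarrow> 'a::complex_hilbert \<Rightarrow>\<^sub>L 'a) \<Rightarrow> ('a \<Rightarrow>\<^sub>L 'a) \<Rightarrow> bool" where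
  "wot_tendsto a l \<longleftrightarrow> (\<forall>x y. (\<lambda>n. cinner (a n x) y) \<longlonglongrightarrow> cinner (l x) y)"


section \<open>Operator matrices\<close>

(* An n by n matrix is a function G of which only the entries G i j with i, j < n matter. *)

definition selfadjoint_mat :: "nat \<Rightarrow> (nat \<Rightarrow> nat \<Rightarrow> 'a::complex_hilbert \<Rightarrow>\<^sub>L 'a) \<Rightarrow> bool" where
  "selfadjoint_mat n G \<longleftrightarrow> (\<forall>i<n. \<forall>j<n. G i j = cadjoint (G j i))"

definition positive_mat :: "nat \<Rightarrow> (nat \<Rightarrow> nat \<Rightarrow> 'a::complex_hilbert \<Rightarrow>\<^sub>L 'a) \<Rightarrow> bool" where
  "positive_mat n G \<longleftrightarrow> selfadjoint_mat n G \<and>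
     (\<forall>x :: nat \<Rightarrow> 'a. (\<Sum>i<n. \<Sum>j<n. cinner (G i j (x j)) (x i)) \<in> \<real>\<^sub>\<ge>\<^sub>0)"


section \<open>Normed spaces of operators and completely positive maps\<close>

definition cnorm_on :: "'v::complex_vector set \<Rightarrow> ('v \<Rightarrow> real) \<Rightarrow> bool" where
  "cnorm_on S N \<longleftrightarrow>
     (\<forall>g\<in>S. 0 \<le> N g) \<and>
     (\<forall>g\<in>S. N g = 0 \<longleftrightarrow> g = 0) \<and>
     (\<forall>c. \<forall>g\<in>S. N (c *\<^sub>C g) = cmod c * N g) \<and>
     (\<forall>g\<in>S. \<forall>h\<in>S. N (g + h) \<le> N g + N h)"

definition complete_wrt :: "'v::complex_vector set \<Rightarrow> ('v \<Rightarrow> real) \<Rightarrow> bool" where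
  "complete_wrt S N \<longleftrightarrow>
     (\<forall>X. (\<forall>n::nat. X n \<in> S) \<and>
          (\<forall>\<epsilon>>0. \<exists>M. \<forall>m\<ge>M. \<forall>n\<ge>M. N (X m - X n) < \<epsilon>) \<longrightarrow>
          (\<exists>l\<in>S. (\<lambda>n. N (X n - l)) \<longlonglongrightarrow> 0))"

definition operator_space :: "('a::complex_hilbert \<Rightarrow>\<^sub>L 'a) set \<Rightarrow> (('a \<Rightarrow>\<^sub>L 'a) \<Rightarrow> real) \<Rightarrow> bool" where
  "operator_space S N \<longleftrightarrow>
     S \<subseteq> bounded_ops \<and>
     csubspace S \<and>
     cnorm_on S N \<and>
     (\<exists>K>0. \<forall>g\<in>S. norm g \<le> K * N g) \<and>
     complete_wrt S N \<and>
     (\<forall>g\<in>S. cadjoint g \<in> S) \<and>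
     (\<forall>g\<in>bounded_ops. finite_rank g \<longrightarrow> g \<in> S)"

definition bounded_clinear_between ::
  "'v::complex_vector set \<Rightarrow> ('v \<Rightarrow> real) \<Rightarrow> 'w::complex_vector set \<Rightarrow> ('w \<Rightarrow> real) \<Rightarrow> ('v \<Rightarrow> 'w) \<Rightarrow> bool" where
  "bounded_clinear_between S N T N' f \<longleftrightarrow>
     f ` S \<subseteq> T \<and>
     (\<forall>g\<in>S. \<forall>h\<in>S. f (g + h) = f g + f h) \<and>
     (\<forall>c. \<forall>g\<in>S. f (c *\<^sub>C g) = c *\<^sub>C f g) \<and>
     (\<exists>C. \<forall>g\<in>S. N' (f g) \<le> C * N g)"

definition completely_positive ::
  "('a::complex_hilbert \<Rightarrow>\<^sub>L 'a) set \<Rightarrow> (('a \<Rightarrow>\<^sub>L 'a) \<Rightarrow> ('b::complex_hilbert \<Rightarrow>\<^sub>L 'b)) \<Rightarrow> bool" where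
  "completely_positive S \<mu> \<longleftrightarrow>
     (\<forall>g\<in>S. cadjoint (\<mu> g) = \<mu> (cadjoint g)) \<and>
     (\<forall>n G. (\<forall>i<n. \<forall>j<n. G i j \<in> S) \<and> positive_mat n G \<longrightarrow>
            positive_mat n (\<lambda>i j. \<mu> (G i j)))"

definition L_mat ::
  "(nat \<Rightarrow> 'a::complex_hilbert) \<Rightarrow> (nat \<Rightarrow> 'b::complex_hilbert) \<Rightarrow>
   (('a \<Rightarrow>\<^sub>L 'a) \<Rightarrow> ('b \<Rightarrow>\<^sub>L 'b)) \<Rightarrow> nat \<Rightarrow> nat \<Rightarrow> nat \<Rightarrow> 'b \<Rightarrow>\<^sub>L 'b" where
  "L_mat e\<^sub>1 e\<^sub>2 \<mu> n i j =
     basis_proj e\<^sub>2 n o\<^sub>L \<mu> (rank_one (e\<^sub>1 i) (e\<^sub>1 j)) o\<^sub>L basis_proj e\<^sub>2 n"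

end

theory Submission
  imports Defs
begin

text \<open>
  Complete positivity applied to the positive matrix of matrix units, compressed by the projections
  of the second space, gives one direction. Conversely, letting \<open>n\<close> grow while the vectors are
  fixed removes the projections: the form of the matrix of the images of the matrix units is
  nonnegative. A compression \<open>P\<^sub>m g P\<^sub>m\<close> is a finite combination of matrix units with
  coefficients \<open>\<langle>g e\<^sub>l, e\<^sub>k\<rangle>\<close>, so for a positive operator matrix \<open>G\<close> the image of its
  compression is a Schur-type product of the scalar positive matrix
  \<open>\<langle>G i j e\<^sub>l, e\<^sub>k\<rangle>\<close> with the positive matrix above, hence positive; then let \<open>m\<close> tend to
  infinity. Over the complex numbers a nonnegative form is automatically selfadjoint, so adjoints
  only have to be computed for the compressions.
\<close>

section \<open>Inner products, adjoints and basis projections\<close>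

lemma bounded_bilinear_cinner: "bounded_bilinear (cinner :: 'a::complex_inner \<Rightarrow> 'a \<Rightarrow> complex)"
proof
  show "\<exists>K. \<forall>a b. norm (cinner a (b::'a)) \<le> norm a * norm b * K"
    by (intro exI[of _ 1]) (simp add: cmod_cinner_le)
qed (simp_all add: cinner_add_left cinner_add_right scaleR_scaleC cinner_scaleC_left
      cinner_scaleC_right scaleR_conv_of_real)

lemmas cinner_sum_left = bounded_bilinear.sum_left[OF bounded_bilinear_cinner]
  and cinner_sum_right = bounded_bilinear.sum_right[OF bounded_bilinear_cinner]
  and cinner_zero_left = bounded_bilinear.zero_left[OF bounded_bilinear_cinner]
  and tendsto_cinner = bounded_bilinear.tendsto[OF bounded_bilinear_cinner]

lemma cinner_ext:
  assumes "\<And>z. cinner z x = cinner z (y::'a::complex_inner)"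
  shows "x = y"
proof -
  have "cinner (x - y) (x - y) = 0" using assms[of "x - y"] by (simp add: cinner_diff_right)
  then show ?thesis by (simp add: cinner_self)
qed

lemma norm_add_orthogonal:
  assumes "cinner x (y::'a::complex_inner) = 0"
  shows "(norm (x + y))\<^sup>2 = (norm x)\<^sup>2 + (norm y)\<^sup>2"
proof -
  have yx: "cinner y x = 0" using assms cinner_commute[of y x] by simp
  have "cinner (x + y) (x + y) = cinner x x + cinner y y"
    by (simp add: cinner_add_left cinner_add_right assms yx)
  then have "complex_of_real ((norm (x + y))\<^sup>2) = of_real ((norm x)\<^sup>2 + (norm y)\<^sup>2)"
    by (simp only: cinner_self of_real_add)
  then show ?thesis unfolding of_real_eq_iff .
qed

section \<open>Orthonormal expansions and the Riesz representation\<close>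

lemma orthonormal_basisD:
  assumes "orthonormal_basis e"
  shows "cinner (e i) (e j) = (if i = j then 1 else 0)" and "closure (cspan (range e)) = UNIV"
  using assms by (auto simp: orthonormal_basis_def)

lemma norm_sum_orthonormal:
  assumes "orthonormal_basis e" "finite A"
  shows "(norm (\<Sum>k\<in>A. c k *\<^sub>C e k))\<^sup>2 = (\<Sum>k\<in>A. (cmod (c k))\<^sup>2)"
proof -
  have "cinner (\<Sum>k\<in>A. c k *\<^sub>C e k) (\<Sum>k\<in>A. c k *\<^sub>C e k)
      = (\<Sum>k\<in>A. c k * cnj (c k))"
    using assms(2) by (simp add: cinner_sum_left cinner_sum_right cinner_scaleC_left
        cinner_scaleC_right orthonormal_basisD[OF assms(1)] if_distrib mult.commute
        cong: if_cong)
  also have "\<dots> = of_real (\<Sum>k\<in>A. (cmod (c k))\<^sup>2)"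
    by (simp add: complex_norm_square del: of_real_power)
  finally show ?thesis unfolding cinner_self of_real_eq_iff .
qed

text \<open>The difference \<open>f - g\<close> vanishes on the span of the basis; the span is dense
  and the difference continuous. Thus a bounded functional is identified by its values on the
  basis.\<close>

lemma orthonormal_ext:
  fixes e :: "nat \<Rightarrow> 'a::complex_hilbert"
  assumes e: "orthonormal_basis e"
    and f: "continuous_on UNIV f" "\<And>x y. f (x + y) = f x + f y" "\<And>c x. f (c *\<^sub>C x) = c * f x"
    and g: "continuous_on UNIV g" "\<And>x y. g (x + y) = g x + g y" "\<And>c x. g (c *\<^sub>C x) = c * g x"
    and eq: "\<And>k. f (e k) = (g (e k) :: complex)"
  shows "f x = g x"
proof -
  have "f x - g x = 0" if "x \<in> closure (cspan (range e))"
  proof (rule continuous_constant_on_closure[OF _ _ that])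
    show "continuous_on (closure (cspan (range e))) (\<lambda>x. f x - g x)"
      using f(1) g(1) by (intro continuous_intros) (auto intro: continuous_on_subset)
    fix x assume "x \<in> cspan (range e)"
    then have "f x = g x"
    proof (induction rule: complex_vector.span_induct_alt)
      case base
      show ?case using f(3)[of 0 0] g(3)[of 0 0] by simp
    next
      case (step c x y)
      then show ?case using eq by (auto simp: f g)
    qed
    then show "f x - g x = 0" by simp
  qed
  then show ?thesis using orthonormal_basisD(2)[OF e] by simp
qed

text \<open>Evaluating \<open>f\<close> at the partial sums \<open>s n\<close> gives \<open>f (s n) = norm (s n)\<^sup>2\<close>, which bounds
  them and makes the expansion converge.\<close>
lemma riesz_orthonormal:
  fixes e :: "nat \<Rightarrow> 'a::complex_hilbert" and f :: "'a \<Rightarrow> complex"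
  assumes e: "orthonormal_basis e"
    and f: "\<And>x y. f (x + y) = f x + f y" "\<And>c x. f (c *\<^sub>C x) = c * f x"
    and C: "\<And>x. cmod (f x) \<le> C * norm x"
  shows "\<exists>z. \<forall>x. f x = cinner x z"
proof -
  \<comment> \<open>Conjugates appear because the inner product is conjugate linear in its second
    argument: \<open>cinner (e k) z = f (e k)\<close> forces exactly these coefficients on
    \<open>z\<close>.\<close>
  define s where "s n = (\<Sum>k<n. cnj (f (e k)) *\<^sub>C e k)" for n
  have f0: "f 0 = 0" using f(2)[of 0 0] by simp
  have fs: "f (s n) = of_real (\<Sum>k<n. (cmod (f (e k)))\<^sup>2)" for n
  proof (induction n)
    case (Suc n)
    then show ?case
      by (simp add: s_def f complex_norm_square mult.commute del: of_real_power)
  qed (simp add: s_def f0)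
  have ns: "(norm (s n))\<^sup>2 = (\<Sum>k<n. (cmod (f (e k)))\<^sup>2)" for n
    unfolding s_def by (subst norm_sum_orthonormal[OF e]) simp_all
  have "(norm (s n))\<^sup>2 \<le> C * norm (s n)" for n
    using C[of "s n"] unfolding fs ns[symmetric] norm_of_real by simp
  \<comment> \<open>Cancel one factor \<open>norm (s n)\<close>; the absolute value covers
    \<open>s n = 0\<close>, where the inequality says nothing about the sign of
    \<open>C\<close>.\<close>
  then have b: "norm (s n) \<le> \<bar>C\<bar>" for n
    by (smt (verit) mult_right_le_imp_le norm_ge_zero power2_eq_square)
  have "summable (\<lambda>k. (cmod (f (e k)))\<^sup>2)"
  proof (rule bounded_imp_summable[where B = "\<bar>C\<bar>\<^sup>2"])
    show "(\<Sum>k\<le>n. (cmod (f (e k)))\<^sup>2) \<le> \<bar>C\<bar>\<^sup>2" for n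
      using power_mono[OF b[of "Suc n"], of 2] unfolding ns lessThan_Suc_atMost by simp
  qed simp
  then have sm: "\<forall>\<epsilon>>0. \<exists>N. \<forall>m\<ge>N. \<forall>n. norm (\<Sum>k = m..<n. (cmod (f (e k)))\<^sup>2) < \<epsilon>"
    unfolding summable_Cauchy .
  have "summable (\<lambda>k. cnj (f (e k)) *\<^sub>C e k)"
    unfolding summable_Cauchy
  proof (intro allI impI)
    fix \<epsilon> :: real assume "\<epsilon> > 0"
    then obtain N where N: "\<And>m n. m \<ge> N \<Longrightarrow> norm (\<Sum>k = m..<n. (cmod (f (e k)))\<^sup>2) < \<epsilon>\<^sup>2"
      using sm by (meson zero_less_power)
    have "norm (\<Sum>k = m..<n. cnj (f (e k)) *\<^sub>C e k) < \<epsilon>" if "m \<ge> N" for m n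
    proof (rule power2_less_imp_less)
      \<comment> \<open>By orthonormality the squared norm of a block of the vector series is a
        block of the scalar series, so the Cauchy criterion is applied to the latter with \<epsilon>
        squared.\<close>
      show "(norm (\<Sum>k = m..<n. cnj (f (e k)) *\<^sub>C e k))\<^sup>2 < \<epsilon>\<^sup>2"
        using N[OF that, of n] by (simp add: norm_sum_orthonormal[OF e] sum_nonneg)
    qed (use \<open>\<epsilon> > 0\<close> in simp)
    then show "\<exists>N. \<forall>m\<ge>N. \<forall>n. norm (\<Sum>k = m..<n. cnj (f (e k)) *\<^sub>C e k) < \<epsilon>" by blast
  qed
  then obtain z where z: "s \<longlonglongrightarrow> z" unfolding summable_def sums_def s_def by blast
  have ez: "cinner (e k) z = f (e k)" for k
  proof (rule LIMSEQ_unique[OF tendsto_cinner[OF tendsto_const z]])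
    have "cinner (e k) (s n) = f (e k)" if "n > k" for n
      using that by (simp add: s_def cinner_sum_right cinner_scaleC_right orthonormal_basisD[OF e]
          if_distrib cong: if_cong)
    then show "(\<lambda>n. cinner (e k) (s n)) \<longlonglongrightarrow> f (e k)"
      by (intro tendsto_eventually eventually_sequentiallyI[of "Suc k"]) simp
  qed
  have "bounded_linear f"
    by (rule bounded_linear_intro[where K = C])
      (use C in \<open>simp_all add: f scaleR_scaleC scaleR_conv_of_real mult.commute\<close>)
  then have "continuous_on UNIV f" by (rule linear_continuous_on)
  moreover have "continuous_on UNIV (\<lambda>x. cinner x z)"
    by (intro linear_continuous_on bounded_bilinear.bounded_linear_left bounded_bilinear_cinner)
  ultimately have "f x = cinner x z" for x
    by (rule orthonormal_ext[OF e _ f]) (simp_all add: cinner_add_left cinner_scaleC_left ez)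
  then show ?thesis by blast
qed

section \<open>Adjoints and rank one operators\<close>

text \<open>With \<open>b\<close> as witness the definite description only needs uniqueness, which
  holds because a vector is determined by its inner products.\<close>

lemma cadjoint_eqI:
  fixes a b :: "'a::complex_hilbert \<Rightarrow>\<^sub>L 'a"
  assumes "\<And>x y. cinner (a x) y = cinner x (b y)"
  shows "cadjoint a = b"
  unfolding cadjoint_def
proof (rule the_equality)
  fix c :: "'a \<Rightarrow>\<^sub>L 'a" assume c: "\<forall>x y. cinner (a x) y = cinner x (c y)"
  show "c = b"
    by (intro blinfun_eqI cinner_ext) (metis assms c)
qed (use assms in simp)

text \<open>The definite description says nothing until an adjoint is known to exist. Riesz
  representation of the functional \<open>cinner (a x) y\<close> in \<open>x\<close> gives its value
  at each \<open>y\<close>; the basis enters only through that representation.\<close>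

lemma cinner_cadjoint_right:
  fixes a :: "'a::complex_hilbert \<Rightarrow>\<^sub>L 'a"
  assumes e: "orthonormal_basis (e :: nat \<Rightarrow> 'a)" and a: "a \<in> bounded_ops"
  shows "cinner (a x) y = cinner x (cadjoint a y)"
proof -
  have "\<exists>z. \<forall>x. cinner (a x) y = cinner x z" for y
  proof (rule riesz_orthonormal[OF e, where C = "norm a * norm y"])
    show "cmod (cinner (a x) y) \<le> norm a * norm y * norm x" for x
      using cmod_cinner_le[of "a x" y] mult_right_mono[OF norm_blinfun[of a x] norm_ge_zero[of y]]
      by (simp add: mult_ac)
  qed (use a in \<open>auto simp: bounded_ops_def blinfun.add_right cinner_add_left cinner_scaleC_left\<close>)
  then obtain b where b: "\<And>x y. cinner (a x) y = cinner x (b y)" by metis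
  have "bounded_linear b"
  proof (rule bounded_linear_intro[where K = "norm a"])
    show "b (x + y) = b x + b y" for x y
      by (rule cinner_ext) (simp add: b[symmetric] cinner_add_right)
    show "b (r *\<^sub>R x) = r *\<^sub>R b x" for r x
      by (rule cinner_ext) (simp add: b[symmetric] scaleR_scaleC cinner_scaleC_right)
    show "norm (b x) \<le> norm x * norm a" for x
    proof (cases "b x = 0")
      case False
      \<comment> \<open>The adjoint identity at \<open>b x\<close> itself bounds the square of the
        norm by a multiple of the norm, and one factor cancels.\<close>
      have "complex_of_real ((norm (b x))\<^sup>2) = cinner (a (b x)) x"
        by (simp add: b cinner_self)
      then have "(norm (b x))\<^sup>2 = cmod (cinner (a (b x)) x)"
        by (metis abs_of_nonneg norm_of_real zero_le_power2)
      also have "\<dots> \<le> norm a * norm (b x) * norm x"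
        using cmod_cinner_le[of "a (b x)" x]
          mult_right_mono[OF norm_blinfun[of a "b x"] norm_ge_zero[of x]] by linarith
      finally show ?thesis using False by (simp add: power2_eq_square mult_ac)
    qed simp
  qed
  then have "cadjoint a = Blinfun b"
    by (intro cadjoint_eqI) (simp add: b bounded_linear_Blinfun_apply)
  then show ?thesis by (simp add: b bounded_linear_Blinfun_apply \<open>bounded_linear b\<close>)
qed

lemma rank_one_apply: "rank_one u v x = cinner x v *\<^sub>C u"
  by transfer simp

lemma cinner_rank_one: "cinner (rank_one u v x) y = cinner x (rank_one v u y)"
  by (simp add: rank_one_apply cinner_scaleC_left cinner_scaleC_right cinner_commute[of u y] mult.commute)

lemma rank_one_in_bounded_ops: "rank_one u v \<in> bounded_ops"
  by (simp add: bounded_ops_def rank_one_apply cinner_scaleC_left scaleC_scaleC)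

lemma finite_rank_rank_one: "finite_rank (rank_one u v)"
  unfolding finite_rank_def
  by (rule exI[of _ "{u}"])
    (auto simp: rank_one_apply intro: complex_vector.span_scale complex_vector.span_base)

section \<open>Projections onto spans of basis vectors and compressions\<close>

text \<open>Two candidates differ at \<open>x\<close> by a vector of \<open>M\<close>, which is also
  a difference of two residuals orthogonal to \<open>M\<close>; it is therefore orthogonal to
  itself.\<close>

lemma orth_proj_eqI:
  fixes p :: "'a::complex_hilbert \<Rightarrow>\<^sub>L 'a"
  assumes M: "csubspace M" and p: "\<And>x. p x \<in> M" "\<And>x y. y \<in> M \<Longrightarrow> cinner (x - p x) y = 0"
  shows "orth_proj M = p"
  unfolding orth_proj_def
proof (rule the_equality)
  fix q assume q: "\<forall>x. blinfun_apply q x \<in> M \<and> (\<forall>y\<in>M. cinner (x - q x) y = 0)"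
  show "q = p"
  proof (rule blinfun_eqI)
    fix x
    have m: "q x - p x \<in> M" using q p M by (simp add: complex_vector.subspace_diff)
    have "cinner (q x - p x) (q x - p x) = cinner (x - p x) (q x - p x) - cinner (x - q x) (q x - p x)"
      by (simp add: cinner_diff_left)
    also have "\<dots> = 0" using q p m by simp
    finally show "q x = p x" by (simp add: cinner_self)
  qed
qed (use p in simp)

lemma cinner_span_zero:
  assumes "y \<in> cspan S" "\<And>z. z \<in> S \<Longrightarrow> cinner x z = 0"
  shows "cinner x y = 0"
  using assms(1)
  by (induction rule: complex_vector.span_induct_alt)
    (auto simp: cinner_zero_right cinner_add_right cinner_scaleC_right assms(2))

context
  fixes e :: "nat \<Rightarrow> 'a::complex_hilbert"
  assumes e: "orthonormal_basis e"
begin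

text \<open>The sum of the operators \<open>rank_one (e k) (e k)\<close> satisfies both defining
  conditions, so uniqueness identifies it with the projection and yields an explicit
  formula.\<close>

lemma basis_proj_apply: "basis_proj e n x = (\<Sum>k<n. cinner x (e k) *\<^sub>C e k)"
  and cinner_minus_basis_proj: "y \<in> cspan (e ` {..<n}) \<Longrightarrow> cinner (x - basis_proj e n x) y = 0"
  and basis_proj_in_span: "basis_proj e n x \<in> cspan (e ` {..<n})"
proof -
  define p where "p = (\<Sum>k<n. rank_one (e k) (e k))"
  have p: "p x = (\<Sum>k<n. cinner x (e k) *\<^sub>C e k)" for x
    by (simp add: p_def blinfun.sum_left rank_one_apply)
  have 1: "p x \<in> cspan (e ` {..<n})" for x
    unfolding p
    by (intro complex_vector.span_sum complex_vector.span_scale complex_vector.span_base) auto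
  have 2: "cinner (x - p x) y = 0" if "y \<in> cspan (e ` {..<n})" for x y
    using that
  proof (rule cinner_span_zero)
    fix z assume "z \<in> e ` {..<n}"
    then obtain j where "j < n" "z = e j" by auto
    then show "cinner (x - p x) z = 0"
      by (simp add: p cinner_diff_left cinner_sum_left cinner_scaleC_left orthonormal_basisD[OF e]
          if_distrib cong: if_cong)
  qed
  have "basis_proj e n = p"
    unfolding basis_proj_def by (rule orth_proj_eqI) (use 1 2 in auto)
  then show "basis_proj e n x = (\<Sum>k<n. cinner x (e k) *\<^sub>C e k)"
    "y \<in> cspan (e ` {..<n}) \<Longrightarrow> cinner (x - basis_proj e n x) y = 0"
    "basis_proj e n x \<in> cspan (e ` {..<n})"
    using p 1 2 by auto
qed

lemma cinner_basis_proj: "cinner (basis_proj e n x) y = cinner x (basis_proj e n y)"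
  by (simp add: basis_proj_apply cinner_sum_left cinner_sum_right cinner_scaleC_left
      cinner_scaleC_right cinner_commute[of "e _" y] mult.commute)

lemma basis_proj_in_bounded_ops: "basis_proj e n \<in> bounded_ops"
  by (simp add: bounded_ops_def basis_proj_apply cinner_scaleC_left
      complex_vector.scale_sum_right scaleC_scaleC)

text \<open>Best approximation by Pythagoras: \<open>x - y\<close> splits into the residual and a
  vector of the span, which are orthogonal.\<close>

lemma norm_minus_basis_proj_le:
  assumes "y \<in> cspan (e ` {..<n})"
  shows "norm (x - basis_proj e n x) \<le> norm (x - y)"
proof (rule power2_le_imp_le)
  have "cinner (x - basis_proj e n x) (basis_proj e n x - y) = 0"
    by (intro cinner_minus_basis_proj complex_vector.span_diff basis_proj_in_span assms)
  from norm_add_orthogonal[OF this]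
  show "(norm (x - basis_proj e n x))\<^sup>2 \<le> (norm (x - y))\<^sup>2" by simp
qed simp

text \<open>Density gives a finite combination \<open>y\<close> close to \<open>x\<close>. Once
  \<open>n\<close> is so large that \<open>y\<close> lies in the span, the projection of
  \<open>x\<close> is at least as close.\<close>

lemma basis_proj_tendsto: "(\<lambda>n. basis_proj e n x) \<longlonglongrightarrow> x"
proof (rule LIMSEQ_I)
  fix \<epsilon> :: real assume "\<epsilon> > 0"
  then obtain y where y: "y \<in> cspan (range e)" "dist y x < \<epsilon>"
    using orthonormal_basisD(2)[OF e] closure_approachable by blast
  from y(1) have "\<exists>N. \<forall>n\<ge>N. y \<in> cspan (e ` {..<n})"
  proof (induction rule: complex_vector.span_induct_alt)
    case base
    show ?case by (simp add: complex_vector.span_zero)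
  next
    case (step c x y)
    then obtain k N where "x = e k" "\<forall>n\<ge>N. y \<in> cspan (e ` {..<n})" by auto
    then show ?case
      \<comment> \<open>The vector \<open>e k\<close> is among the first \<open>n\<close> only when
        \<open>n > k\<close>, hence \<open>Suc k\<close>.\<close>
      by (intro exI[of _ "max N (Suc k)"])
        (auto intro!: complex_vector.span_add complex_vector.span_scale
          intro: complex_vector.span_base)
  qed
  then obtain N where N: "\<And>n. n \<ge> N \<Longrightarrow> y \<in> cspan (e ` {..<n})" by blast
  have "norm (basis_proj e n x - x) < \<epsilon>" if "n \<ge> N" for n
    using norm_minus_basis_proj_le[OF N[OF that], of x] y(2)
    by (simp add: dist_norm norm_minus_commute)
  then show "\<exists>N. \<forall>n\<ge>N. norm (basis_proj e n x - x) < \<epsilon>" by blast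
qed

text \<open>Expanding both projections in the basis leaves the matrix entries of \<open>g\<close> as
  coefficients of matrix units. The sum is finite, so a map that is merely linear can be applied
  termwise.\<close>

lemma compress_eq_sum:
  assumes "g \<in> bounded_ops"
  shows "basis_proj e m o\<^sub>L g o\<^sub>L basis_proj e m
    = (\<Sum>k<m. \<Sum>l<m. cinner (g (e l)) (e k) *\<^sub>C rank_one (e k) (e l))"
proof (rule blinfun_eqI)
  fix x
  show "(basis_proj e m o\<^sub>L g o\<^sub>L basis_proj e m) x
    = (\<Sum>k<m. \<Sum>l<m. cinner (g (e l)) (e k) *\<^sub>C rank_one (e k) (e l)) x"
    using assms
    by (simp add: bounded_ops_def basis_proj_apply blinfun.sum_left blinfun.sum_right scaleC_blinfun.rep_eq rank_one_apply
        cinner_sum_left cinner_scaleC_left complex_vector.scale_sum_left scaleC_scaleC mult.commute)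
      (rule sum.swap)
qed

end

section \<open>Positive forms\<close>

text \<open>The choice \<open>c = 1\<close> makes the imaginary parts opposite, and
  \<open>c = \<i>\<close> makes the real parts equal.\<close>

lemma cnj_eq_of_real_combination:
  assumes "\<And>c. cnj c * \<alpha> + c * \<beta> \<in> \<real>"
  shows "\<alpha> = cnj \<beta>"
  using assms[of 1] assms[of \<i>] by (simp add: complex_is_Real_iff complex_eq_iff)

text \<open>Polarization: the form is real on the diagonal, hence so is the mixed part
  \<open>B u w + B w u\<close>. Vectors supported in one coordinate reduce it to the entries at
  \<open>(i, j)\<close> and \<open>(j, i)\<close>.\<close>

lemma form_nonneg_imp_adjoint:
  fixes G :: "nat \<Rightarrow> nat \<Rightarrow> 'a::complex_hilbert \<Rightarrow>\<^sub>L 'a"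
  assumes G: "\<And>i j. i < n \<Longrightarrow> j < n \<Longrightarrow> G i j \<in> bounded_ops"
    and pos: "\<And>x. (\<Sum>i<n. \<Sum>j<n. cinner (G i j (x j)) (x i)) \<in> \<real>\<^sub>\<ge>\<^sub>0"
    and ij: "i < n" "j < n"
  shows "cinner (G i j x) y = cinner x (G j i y)"
proof -
  define B where "B u w = (\<Sum>k<n. \<Sum>l<n. cinner (G k l (u l)) (w k))" for u w
  have Breal: "B u u \<in> \<real>" for u
    using pos[of u] nonneg_Reals_subset_Reals unfolding B_def by blast
  have Badd: "B (\<lambda>k. u k + w k) (\<lambda>k. u k + w k) = B u u + B w w + (B u w + B w u)" for u w
    by (simp add: B_def blinfun.add_right cinner_add_left cinner_add_right sum.distrib)
  have Bcross: "B u w + B w u \<in> \<real>" for u w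
    by (metis Badd Breal Reals_add Reals_diff add_diff_cancel_left')
  have Bdelta: "B (\<lambda>k. if k = j then x else 0) (\<lambda>k. if k = i then y else 0) = cinner (G i j x) y"
    if "i < n" "j < n" for i j x y
  proof -
    have "cinner (G k l (if l = j then x else 0)) (if k = i then y else 0)
        = (if l = j then if k = i then cinner (G i j x) y else 0 else 0)" for k l
      by (simp add: cinner_zero_left cinner_zero_right)
    then show ?thesis using that by (simp add: B_def)
  qed
  have "cinner (G i j x) y = cnj (cinner (G j i y) x)"
  proof (rule cnj_eq_of_real_combination)
    fix c
    show "cnj c * cinner (G i j x) y + c * cinner (G j i y) x \<in> \<real>"
      \<comment> \<open>The free scalar \<open>c\<close> sits in the vector at \<open>i\<close>: it
        leaves the second argument conjugated and passes through \<open>G j i\<close> by complex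
        linearity.\<close>
      using Bcross[of "\<lambda>k. if k = j then x else 0" "\<lambda>k. if k = i then c *\<^sub>C y else 0"] G[OF ij(2,1)] ij
      by (simp add: Bdelta cinner_scaleC_right cinner_scaleC_left bounded_ops_def)
  qed
  then show ?thesis by (metis cinner_commute)
qed

text \<open>Polarization supplies selfadjointness, so positivity can be proved by examining the form
  alone.\<close>

lemma positive_matI:
  assumes "\<And>i j. i < n \<Longrightarrow> j < n \<Longrightarrow> G i j \<in> bounded_ops"
    and "\<And>x. (\<Sum>i<n. \<Sum>j<n. cinner (G i j (x j)) (x i)) \<in> \<real>\<^sub>\<ge>\<^sub>0"
  shows "positive_mat n G"
  unfolding positive_mat_def selfadjoint_mat_def
proof (intro conjI allI impI)
  show "G i j = cadjoint (G j i)" if "i < n" "j < n" for i j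
    by (rule cadjoint_eqI[symmetric], rule form_nonneg_imp_adjoint[OF assms that(2,1)])
qed (rule assms(2))

section \<open>Positive scalar matrices and Schur products\<close>

text \<open>With a zero at \<open>(p, p)\<close> the form is only affine in the entry at
  \<open>p\<close>, so a nonzero off-diagonal entry could drive it below zero.\<close>

lemma psd_zero_diagonal:
  assumes I: "finite I" "p \<in> I" "q \<in> I"
    and herm: "\<And>p q. p \<in> I \<Longrightarrow> q \<in> I \<Longrightarrow> A p q = cnj (A q p)"
    and pos: "\<And>x. (\<Sum>p\<in>I. \<Sum>q\<in>I. A p q * x q * cnj (x p)) \<in> \<real>\<^sub>\<ge>\<^sub>0"
    and 0: "A p p = 0"
  shows "A q p = (0::complex)"
proof (rule ccontr)
  assume nz: "A q p \<noteq> 0"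
  then have pq: "p \<noteq> q" using 0 by auto
  \<comment> \<open>Chosen so that the real part of the form at the vector \<open>x\<close> below is
    -1.\<close>
  define t where "t = (Re (A q q) + 1) / (2 * (cmod (A q p))\<^sup>2)"
  define c where "c = - of_real t * cnj (A q p)"
  define x where "x r = (if r = q then 1 else if r = p then c else 0)" for r
  have row: "(\<Sum>s\<in>I. A r s * x s * z) = (A r q + A r p * c) * z" for r z
  proof -
    have "(\<Sum>s\<in>I. A r s * x s * z) = (\<Sum>s\<in>I. (if s = q then A r q * z else 0) + (if s = p then A r p * c * z else 0))"
      using pq by (intro sum.cong) (auto simp: x_def)
    then show ?thesis using I by (simp add: sum.distrib distrib_right)
  qed
  have "(\<Sum>r\<in>I. \<Sum>s\<in>I. A r s * x s * cnj (x r))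
      = (\<Sum>r\<in>I. (if r = q then A q q + A q p * c else 0) + (if r = p then (A p q + A p p * c) * cnj c else 0))"
    unfolding row using pq by (intro sum.cong) (auto simp: x_def)
  also have "\<dots> = A q q + A q p * c + A p q * cnj c"
    using I 0 by (simp add: sum.distrib)
  also have "\<dots> = A q q - 2 * of_real t * of_real ((cmod (A q p))\<^sup>2)"
    unfolding herm[OF I(2,3)] by (simp add: c_def complex_norm_square algebra_simps del: of_real_power)
  also have "\<dots> = A q q - of_real (Re (A q q) + 1)"
    using nz by (simp add: t_def field_simps)
  finally have "A q q - of_real (Re (A q q) + 1) \<in> \<real>\<^sub>\<ge>\<^sub>0" using pos[of x] by simp
  then show False by (simp add: complex_nonneg_Reals_iff)
qed

text \<open>Cholesky decomposition, by induction on the index set: the Schur complement of a diagonal entry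
  is again positive. A zero diagonal entry has a zero row, so the convention \<open>x / 0 = 0\<close>
  makes the formulas cover that case too.\<close>
lemma psd_eq_sum_rank_one:
  fixes A :: "'i \<Rightarrow> 'i \<Rightarrow> complex"
  assumes "finite I"
    and "\<And>p q. p \<in> I \<Longrightarrow> q \<in> I \<Longrightarrow> A p q = cnj (A q p)"
    and "\<And>x. (\<Sum>p\<in>I. \<Sum>q\<in>I. A p q * x q * cnj (x p)) \<in> \<real>\<^sub>\<ge>\<^sub>0"
  shows "\<exists>v. \<forall>p\<in>I. \<forall>q\<in>I. A p q = (\<Sum>r\<in>I. v r p * cnj (v r q))"
  using assms
proof (induction I arbitrary: A rule: finite_induct)
  case (insert p I)
  note herm = insert.prems(1) and pos = insert.prems(2)
  have fin: "finite (insert p I)" using insert.hyps by simp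
  define a where "a = Re (A p p)"
  have App: "A p p = of_real a"
    unfolding a_def by (metis Reals_cnj_iff herm insertI1 of_real_Re)
  have "a \<ge> 0"
  proof -
    have "(\<Sum>r\<in>insert p I. \<Sum>s\<in>insert p I. A r s * (if s = p then 1 else 0) * cnj (if r = p then 1 else 0)) = A p p"
      using insert.hyps by (simp add: sum.neutral)
    then show ?thesis using pos[of "\<lambda>s. if s = p then 1 else 0"] by (simp add: App)
  qed
  have zero: "A q p = 0 \<and> A p q = 0" if "a = 0" "q \<in> insert p I" for q
  proof -
    have "A q p = 0"
      by (rule psd_zero_diagonal[OF fin insertI1 that(2) herm pos]) (simp_all add: App that)
    then show ?thesis using herm[OF insertI1 that(2)] by simp
  qed
  define A' where "A' q s = A q s - A q p * A p s / of_real a" for q s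
  have "\<exists>v. \<forall>q\<in>I. \<forall>s\<in>I. A' q s = (\<Sum>r\<in>I. v r q * cnj (v r s))"
  proof (rule insert.IH)
    show "A' q s = cnj (A' s q)" if "q \<in> I" "s \<in> I" for q s
      using herm[of q s] herm[of q p] herm[of p s] that
      by (simp add: A'_def mult.commute)
    fix x
    define S where "S = (\<Sum>s\<in>I. A p s * x s)"
    \<comment> \<open>Completing the square: for \<open>a > 0\<close> this entry at \<open>p\<close>
      minimizes the form of \<open>A\<close> with the entries on \<open>I\<close> fixed, and the
      minimum is the form of the Schur complement at \<open>x\<close>.\<close>
    define y where "y q = (if q = p then - S / of_real a else x q)" for q
    have yI: "(\<Sum>q\<in>I. h q (y q)) = (\<Sum>q\<in>I. h q (x q))" for h :: "'i \<Rightarrow> complex \<Rightarrow> complex"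
      using insert.hyps by (intro sum.cong) (auto simp: y_def)
    have S': "(\<Sum>q\<in>I. A q p * cnj (x q)) = cnj S"
      unfolding S_def cnj_sum using herm[OF insertI2 insertI1] by (intro sum.cong) auto
    have "(\<Sum>q\<in>I. \<Sum>s\<in>I. A' q s * x s * cnj (x q))
        = (\<Sum>q\<in>I. \<Sum>s\<in>I. A q s * x s * cnj (x q)) - (\<Sum>q\<in>I. A q p * cnj (x q)) * S / of_real a"
      by (simp add: A'_def S_def sum_subtractf sum_product sum_divide_distrib algebra_simps
          diff_divide_distrib) (rule sum.swap)
    also have "\<dots> = (\<Sum>q\<in>I. \<Sum>s\<in>I. A q s * x s * cnj (x q)) - cnj S * S / of_real a"
      by (simp only: S')
    also have "\<dots> = (\<Sum>q\<in>insert p I. \<Sum>s\<in>insert p I. A q s * y s * cnj (y q))"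
    proof -
      have yp: "y p = - S / of_real a" by (simp add: y_def)
      have r: "(\<Sum>s\<in>insert p I. A q s * y s * z) = A q p * y p * z + (\<Sum>s\<in>I. A q s * x s * z)" for q z
        using insert.hyps by (simp add: yI[of "\<lambda>s t. A q s * t * z"])
      have "(\<Sum>q\<in>insert p I. \<Sum>s\<in>insert p I. A q s * y s * cnj (y q))
        = (A p p * y p + S) * cnj (y p) + (\<Sum>q\<in>I. A q p * y p * cnj (x q) + (\<Sum>s\<in>I. A q s * x s * cnj (x q)))"
        unfolding r using insert.hyps
        by (simp add: yI[of "\<lambda>q t. A q p * y p * cnj t + (\<Sum>s\<in>I. A q s * x s * cnj t)"]
            S_def distrib_right sum_distrib_right)
      also have "(\<Sum>q\<in>I. A q p * y p * cnj (x q) + (\<Sum>s\<in>I. A q s * x s * cnj (x q)))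
        = y p * cnj S + (\<Sum>q\<in>I. \<Sum>s\<in>I. A q s * x s * cnj (x q))"
        by (simp add: S'[symmetric] sum.distrib sum_distrib_left mult_ac)
      finally show ?thesis by (cases "a = 0") (simp_all add: yp App)
    qed
    also have "\<dots> \<in> \<real>\<^sub>\<ge>\<^sub>0" by (rule pos)
    finally show "(\<Sum>q\<in>I. \<Sum>s\<in>I. A' q s * x s * cnj (x q)) \<in> \<real>\<^sub>\<ge>\<^sub>0" .
  qed
  then obtain v where v: "\<And>q s. q \<in> I \<Longrightarrow> s \<in> I \<Longrightarrow> A' q s = (\<Sum>r\<in>I. v r q * cnj (v r s))" by blast
  \<comment> \<open>The vectors are labelled by the index set itself. The new label \<open>p\<close>
    gets the normalized column at \<open>p\<close>; the old vectors are extended by zero at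
    \<open>p\<close>.\<close>
  define w where "w r q = (if r = p then A q p / of_real (sqrt a) else if q = p then 0 else v r q)" for r q
  have sq: "complex_of_real (sqrt a) * of_real (sqrt a) = of_real a"
    using \<open>a \<ge> 0\<close> by (metis of_real_mult real_sqrt_mult_self abs_of_nonneg)
  have "A q s = (\<Sum>r\<in>insert p I. w r q * cnj (w r s))" if "q \<in> insert p I" "s \<in> insert p I" for q s
  proof -
    have "(\<Sum>r\<in>insert p I. w r q * cnj (w r s)) = w p q * cnj (w p s) + (\<Sum>r\<in>I. w r q * cnj (w r s))"
      using insert.hyps by simp
    also have "w p q * cnj (w p s) = A q p * A p s / of_real a"
      using herm[of p s] that by (simp add: w_def sq)
    also have "(\<Sum>r\<in>I. w r q * cnj (w r s)) = (if q = p \<or> s = p then 0 else A' q s)"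
    proof (cases "q = p \<or> s = p")
      case True
      then show ?thesis using insert.hyps by (auto simp: w_def intro!: sum.neutral)
    next
      case False
      then have "q \<in> I" "s \<in> I" using that by auto
      from v[OF this] show ?thesis using insert.hyps False by (auto simp: w_def intro!: sum.cong)
    qed
    \<comment> \<open>If \<open>q\<close> or \<open>s\<close> equals \<open>p\<close>, the first
      term alone must give \<open>A q s\<close>: for nonzero \<open>a\<close> because
      \<open>A p p = a\<close>, for \<open>a = 0\<close> because everything in sight
      vanishes.\<close>
    finally show ?thesis
      using zero[of q] zero[of s] that App by (cases "a = 0") (auto simp: A'_def)
  qed
  then show ?case by blast
qed simp

text \<open>A Schur product argument: decompose the scalar matrix into rank one matrices.\<close>
lemma schur_form_nonneg:
  fixes B :: "nat \<Rightarrow> nat \<Rightarrow> 'b::complex_hilbert \<Rightarrow>\<^sub>L 'b" and A :: "nat \<times> nat \<Rightarrow> nat \<times> nat \<Rightarrow> complex"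
  assumes B: "\<And>k l. B k l \<in> bounded_ops"
    and Bpos: "\<And>y. (\<Sum>k<m. \<Sum>l<m. cinner (B k l (y l)) (y k)) \<in> \<real>\<^sub>\<ge>\<^sub>0"
    and herm: "\<And>p q. p \<in> {..<n} \<times> {..<m} \<Longrightarrow> q \<in> {..<n} \<times> {..<m} \<Longrightarrow> A p q = cnj (A q p)"
    and pos: "\<And>x. (\<Sum>p\<in>{..<n} \<times> {..<m}. \<Sum>q\<in>{..<n} \<times> {..<m}. A p q * x q * cnj (x p)) \<in> \<real>\<^sub>\<ge>\<^sub>0"
  shows "(\<Sum>i<n. \<Sum>j<n. \<Sum>k<m. \<Sum>l<m. A (i, k) (j, l) * cinner (B k l (x j)) (x i)) \<in> \<real>\<^sub>\<ge>\<^sub>0"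
proof -
  let ?I = "{..<n} \<times> {..<m}"
  obtain v where v: "\<And>p q. p \<in> ?I \<Longrightarrow> q \<in> ?I \<Longrightarrow> A p q = (\<Sum>r\<in>?I. v r p * cnj (v r q))"
    using psd_eq_sum_rank_one[of ?I A] herm pos by blast
  \<comment> \<open>The \<open>r\<close>-th rank one summand of \<open>A\<close> has product
    coefficients, which can be absorbed into the vectors; its share is then the form of
    \<open>B\<close> at \<open>y r\<close>.\<close>
  define y where "y r l = (\<Sum>j<n. cnj (v r (j, l)) *\<^sub>C x j)" for r l
  have y: "(\<Sum>k<m. \<Sum>l<m. cinner (B k l (y r l)) (y r k))
      = (\<Sum>k<m. \<Sum>l<m. \<Sum>i<n. \<Sum>j<n. v r (i, k) * cnj (v r (j, l)) * cinner (B k l (x j)) (x i))" for r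
    using B by (simp add: y_def bounded_ops_def blinfun.sum_right cinner_sum_left cinner_sum_right
        cinner_scaleC_left cinner_scaleC_right sum_distrib_left mult_ac)
  have "(\<Sum>i<n. \<Sum>j<n. \<Sum>k<m. \<Sum>l<m. A (i, k) (j, l) * cinner (B k l (x j)) (x i))
      = (\<Sum>i<n. \<Sum>j<n. \<Sum>k<m. \<Sum>l<m. \<Sum>r\<in>?I. v r (i, k) * cnj (v r (j, l)) * cinner (B k l (x j)) (x i))"
    by (intro sum.cong refl) (simp add: v sum_distrib_right)
  also have "\<dots> = (\<Sum>r\<in>?I. \<Sum>i<n. \<Sum>j<n. \<Sum>k<m. \<Sum>l<m. v r (i, k) * cnj (v r (j, l)) * cinner (B k l (x j)) (x i))"
    by (simp only: sum.swap[of _ ?I])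
  also have "\<dots> = (\<Sum>r\<in>?I. \<Sum>k<m. \<Sum>l<m. \<Sum>i<n. \<Sum>j<n. v r (i, k) * cnj (v r (j, l)) * cinner (B k l (x j)) (x i))"
    by (simp only: sum.swap[of _ "{..<m}" "{..<n}"])
  also have "\<dots> = (\<Sum>r\<in>?I. \<Sum>k<m. \<Sum>l<m. cinner (B k l (y r l)) (y r k))"
    by (simp only: y)
  also have "\<dots> \<in> \<real>\<^sub>\<ge>\<^sub>0"
    using Bpos by (simp add: complex_nonneg_Reals_iff sum_nonneg)
  finally show ?thesis .
qed

section \<open>Complete positivity\<close>

context
  fixes e\<^sub>1 :: "nat \<Rightarrow> 'a::complex_hilbert"
    and e\<^sub>2 :: "nat \<Rightarrow> 'b::complex_hilbert"
    and \<Sigma>\<^sub>1 N\<^sub>1 \<Sigma>\<^sub>2 N\<^sub>2 and \<mu> :: "('a \<Rightarrow>\<^sub>L 'a) \<Rightarrow> ('b \<Rightarrow>\<^sub>L 'b)"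
  assumes e\<^sub>1: "orthonormal_basis e\<^sub>1" and e\<^sub>2: "orthonormal_basis e\<^sub>2"
    and S1: "operator_space \<Sigma>\<^sub>1 N\<^sub>1" and S2: "operator_space \<Sigma>\<^sub>2 N\<^sub>2"
    and \<mu>: "bounded_clinear_between \<Sigma>\<^sub>1 N\<^sub>1 \<Sigma>\<^sub>2 N\<^sub>2 \<mu>"
begin

section \<open>The map on finite combinations of matrix units\<close>

lemma subspace_dom: "csubspace \<Sigma>\<^sub>1"
  using S1 by (simp add: operator_space_def)

lemma dom_bounded_ops: "g \<in> \<Sigma>\<^sub>1 \<Longrightarrow> g \<in> bounded_ops"
  using S1 by (auto simp: operator_space_def)

lemma map_bounded_ops: "g \<in> \<Sigma>\<^sub>1 \<Longrightarrow> \<mu> g \<in> bounded_ops"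
  using \<mu> S2 by (auto simp: bounded_clinear_between_def operator_space_def)

lemma rank_one_in_dom: "rank_one u v \<in> \<Sigma>\<^sub>1"
  using S1 by (simp add: operator_space_def rank_one_in_bounded_ops finite_rank_rank_one)

lemma map_add: "g \<in> \<Sigma>\<^sub>1 \<Longrightarrow> h \<in> \<Sigma>\<^sub>1 \<Longrightarrow> \<mu> (g + h) = \<mu> g + \<mu> h"
  and map_scaleC: "g \<in> \<Sigma>\<^sub>1 \<Longrightarrow> \<mu> (c *\<^sub>C g) = c *\<^sub>C \<mu> g"
  using \<mu> by (auto simp: bounded_clinear_between_def)

text \<open>Linearity is available only inside \<open>\<Sigma>\<^sub>1\<close>, so the induction
  must keep every partial sum there.\<close>

lemma map_sum:
  assumes "finite A" "\<And>k. k \<in> A \<Longrightarrow> h k \<in> \<Sigma>\<^sub>1"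
  shows "\<mu> (\<Sum>k\<in>A. h k) = (\<Sum>k\<in>A. \<mu> (h k))"
  using assms
proof (induction A rule: finite_induct)
  case empty
  show ?case
    using map_scaleC[of 0 0] complex_vector.subspace_0[OF subspace_dom] by simp
next
  case (insert k A)
  then show ?case by (simp add: map_add complex_vector.subspace_sum[OF subspace_dom])
qed

text \<open>Reduces every statement about images of compressions to the images of matrix units and
  the scalar entries of \<open>g\<close>.\<close>

lemma cinner_map_compress:
  assumes "g \<in> \<Sigma>\<^sub>1"
  shows "cinner (\<mu> (basis_proj e\<^sub>1 m o\<^sub>L g o\<^sub>L basis_proj e\<^sub>1 m) x) y
    = (\<Sum>k<m. \<Sum>l<m. cinner (g (e\<^sub>1 l)) (e\<^sub>1 k) * cinner (\<mu> (rank_one (e\<^sub>1 k) (e\<^sub>1 l)) x) y)"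
proof -
  note in_dom = complex_vector.subspace_sum[OF subspace_dom]
    complex_vector.subspace_scale[OF subspace_dom] rank_one_in_dom
  show ?thesis
    unfolding compress_eq_sum[OF e\<^sub>1 dom_bounded_ops[OF assms]]
    by (simp add: map_sum map_scaleC in_dom blinfun.sum_left scaleC_blinfun.rep_eq cinner_sum_left cinner_scaleC_left)
qed

section \<open>The two implications\<close>

text \<open>The projections converge pointwise to the identity, and the nonnegative reals are
  closed, so it is enough to treat projected vectors for large \<open>n\<close>.\<close>

lemma L_mat_nonneg_imp_form_nonneg:
  assumes L: "\<And>n. positive_mat n (L_mat e\<^sub>1 e\<^sub>2 \<mu> n)"
  shows "(\<Sum>k<m. \<Sum>l<m. cinner (\<mu> (rank_one (e\<^sub>1 k) (e\<^sub>1 l)) (y l)) (y k)) \<in> \<real>\<^sub>\<ge>\<^sub>0"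
proof -
  let ?b = "\<lambda>k l. \<mu> (rank_one (e\<^sub>1 k) (e\<^sub>1 l))" and ?P = "basis_proj e\<^sub>2"
  have "(\<lambda>n. \<Sum>k<m. \<Sum>l<m. cinner (?b k l (?P n (y l))) (?P n (y k)))
      \<longlonglongrightarrow> (\<Sum>k<m. \<Sum>l<m. cinner (?b k l (y l)) (y k))"
    by (intro tendsto_sum tendsto_cinner blinfun.tendsto tendsto_const basis_proj_tendsto e\<^sub>2)
  moreover have "(\<Sum>k<m. \<Sum>l<m. cinner (?b k l (?P n (y l))) (?P n (y k))) \<in> \<real>\<^sub>\<ge>\<^sub>0" if "n \<ge> m" for n
  proof -
    \<comment> \<open>\<open>L_mat\<close> ties the matrix size to the rank of the projection.
      Padding by zero vectors turns the form of size \<open>m\<close> into one of size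
      \<open>n\<close> without changing its value.\<close>
    define z where "z k = (if k < m then y k else 0)" for k
    have "(\<Sum>k<m. \<Sum>l<m. cinner (?b k l (?P n (y l))) (?P n (y k)))
        = (\<Sum>k<m. \<Sum>l<m. cinner (?b k l (?P n (z l))) (?P n (z k)))"
      by (simp add: z_def)
    also have "\<dots> = (\<Sum>k<m. \<Sum>l<n. cinner (?b k l (?P n (z l))) (?P n (z k)))"
      using that
      by (intro sum.cong sum.mono_neutral_left) (auto simp: z_def blinfun.zero_right cinner_zero_left)
    also have "\<dots> = (\<Sum>k<n. \<Sum>l<n. cinner (?b k l (?P n (z l))) (?P n (z k)))"
      using that
      by (intro sum.mono_neutral_left) (auto simp: z_def blinfun.zero_right cinner_zero_right)
    also have "\<dots> = (\<Sum>k<n. \<Sum>l<n. cinner (L_mat e\<^sub>1 e\<^sub>2 \<mu> n k l (z l)) (z k))"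
      by (simp add: L_mat_def cinner_basis_proj[OF e\<^sub>2])
    also have "\<dots> \<in> \<real>\<^sub>\<ge>\<^sub>0" using L[of n] by (simp add: positive_mat_def)
    finally show ?thesis .
  qed
  ultimately show ?thesis
    by (intro Lim_in_closed_set[OF closed_nonneg_Reals_complex])
      (auto simp: eventually_sequentially)
qed

lemma completely_positive_imp_L_mat:
  assumes "completely_positive \<Sigma>\<^sub>1 \<mu>"
  shows "positive_mat n (L_mat e\<^sub>1 e\<^sub>2 \<mu> n)"
proof -
  have "positive_mat n (\<lambda>i j. rank_one (e\<^sub>1 i) (e\<^sub>1 j))"
  proof (rule positive_matI[OF rank_one_in_bounded_ops])
    fix x
    \<comment> \<open>The form factors: index \<open>j\<close> contributes
      \<open>cinner (x j) (e\<^sub>1 j)\<close> and index \<open>i\<close> the conjugate of the same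
      expression, so it is the squared modulus of \<open>?w\<close>.\<close>
    let ?w = "\<Sum>j<n. cinner (x j) (e\<^sub>1 j)"
    have "(\<Sum>i<n. \<Sum>j<n. cinner (rank_one (e\<^sub>1 i) (e\<^sub>1 j) (x j)) (x i)) = cnj ?w * ?w"
      by (simp add: rank_one_apply cinner_scaleC_left sum_product cinner_commute[of "e\<^sub>1 _" "x _"] mult.commute)
        (rule sum.swap)
    also have "\<dots> = of_real ((cmod ?w)\<^sup>2)"
      by (metis complex_norm_square mult.commute)
    finally show "(\<Sum>i<n. \<Sum>j<n. cinner (rank_one (e\<^sub>1 i) (e\<^sub>1 j) (x j)) (x i)) \<in> \<real>\<^sub>\<ge>\<^sub>0"
      by (simp del: of_real_power)
  qed
  then have b: "positive_mat n (\<lambda>i j. \<mu> (rank_one (e\<^sub>1 i) (e\<^sub>1 j)))"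
    using assms rank_one_in_dom by (simp add: completely_positive_def)
  show ?thesis
  proof (rule positive_matI)
    show "L_mat e\<^sub>1 e\<^sub>2 \<mu> n i j \<in> bounded_ops" for i j
      using map_bounded_ops[OF rank_one_in_dom] basis_proj_in_bounded_ops[OF e\<^sub>2]
      by (simp add: L_mat_def bounded_ops_def)
    \<comment> \<open>The projections are selfadjoint and move onto the vectors, where they are just
      another choice of vectors.\<close>
    show "(\<Sum>i<n. \<Sum>j<n. cinner (L_mat e\<^sub>1 e\<^sub>2 \<mu> n i j (x j)) (x i)) \<in> \<real>\<^sub>\<ge>\<^sub>0" for x
      using b by (simp add: positive_mat_def L_mat_def cinner_basis_proj[OF e\<^sub>2])
  qed
qed

text \<open>Both conditions are checked on compressions, where all sums are finite, and are
  preserved by weak limits.\<close>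

lemma L_mat_imp_completely_positive:
  assumes L: "\<And>n. positive_mat n (L_mat e\<^sub>1 e\<^sub>2 \<mu> n)"
    and wot: "\<And>g. g \<in> \<Sigma>\<^sub>1 \<Longrightarrow> wot_tendsto (\<lambda>n. \<mu> (basis_proj e\<^sub>1 n o\<^sub>L g o\<^sub>L basis_proj e\<^sub>1 n)) (\<mu> g)"
  shows "completely_positive \<Sigma>\<^sub>1 \<mu>"
proof -
  define b where "b k l = \<mu> (rank_one (e\<^sub>1 k) (e\<^sub>1 l))" for k l
  define T where "T m g = \<mu> (basis_proj e\<^sub>1 m o\<^sub>L g o\<^sub>L basis_proj e\<^sub>1 m)" for m g
  have T: "cinner (T m g x) y = (\<Sum>k<m. \<Sum>l<m. cinner (g (e\<^sub>1 l)) (e\<^sub>1 k) * cinner (b k l x) y)"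
    if "g \<in> \<Sigma>\<^sub>1" for m g x y
    unfolding T_def b_def by (rule cinner_map_compress[OF that])
  have lim: "(\<lambda>m. cinner (T m g x) y) \<longlonglongrightarrow> cinner (\<mu> g x) y" if "g \<in> \<Sigma>\<^sub>1" for g x y
    using wot[OF that] by (simp add: wot_tendsto_def T_def)
  have b: "b k l \<in> bounded_ops" for k l
    unfolding b_def by (intro map_bounded_ops rank_one_in_dom)
  have bpos: "(\<Sum>k<m. \<Sum>l<m. cinner (b k l (y l)) (y k)) \<in> \<real>\<^sub>\<ge>\<^sub>0" for m y
    unfolding b_def by (rule L_mat_nonneg_imp_form_nonneg[OF L])
  \<comment> \<open>Nonnegativity holds in every size, so any size exceeding both indices will
    do.\<close>
  have badj: "cinner (b k l x) y = cinner x (b l k y)" for k l x y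
    by (rule form_nonneg_imp_adjoint[of "Suc (max k l)" b, OF b bpos]) auto
  have adj: "cinner (g x) y = cinner x (cadjoint g y)" if "g \<in> \<Sigma>\<^sub>1" for g x y
    by (rule cinner_cadjoint_right[OF e\<^sub>1 dom_bounded_ops[OF that]])
  have adj_dom: "cadjoint g \<in> \<Sigma>\<^sub>1" if "g \<in> \<Sigma>\<^sub>1" for g
    using S1 that by (simp add: operator_space_def)
  have "cadjoint (\<mu> g) = \<mu> (cadjoint g)" if g: "g \<in> \<Sigma>\<^sub>1" for g
  proof (rule cadjoint_eqI)
    fix x y
    \<comment> \<open>Passing to the adjoint conjugates and transposes the coefficients of
      \<open>g\<close> and turns \<open>b k l\<close> into \<open>b l k\<close>; together this only
      renames the summation indices.\<close>
    have "cinner (T m g x) y = cnj (cinner (T m (cadjoint g) y) x)" for m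
    proof -
      have "cnj (cinner (T m (cadjoint g) y) x)
          = (\<Sum>k<m. \<Sum>l<m. cinner (g (e\<^sub>1 k)) (e\<^sub>1 l) * cinner (b l k x) y)"
        unfolding T[OF adj_dom[OF g]] cnj_sum complex_cnj_mult
        by (simp only: cinner_commute[symmetric] adj[OF g, symmetric] badj[symmetric])
      also have "\<dots> = cinner (T m g x) y"
        unfolding T[OF g] by (rule sum.swap)
      finally show ?thesis by simp
    qed
    then have "(\<lambda>m. cinner (T m g x) y) \<longlonglongrightarrow> cnj (cinner (\<mu> (cadjoint g) y) x)"
      using tendsto_cnj[OF lim[OF adj_dom[OF g], of y x]] by simp
    from LIMSEQ_unique[OF lim[OF g] this]
    show "cinner (\<mu> g x) y = cinner x (\<mu> (cadjoint g) y)"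
      by (metis cinner_commute)
  qed
  moreover have "positive_mat n (\<lambda>i j. \<mu> (G i j))"
    if G: "\<And>i j. i < n \<Longrightarrow> j < n \<Longrightarrow> G i j \<in> \<Sigma>\<^sub>1" and Gpos: "positive_mat n G" for n G
  proof (rule positive_matI)
    show "\<mu> (G i j) \<in> bounded_ops" if "i < n" "j < n" for i j
      using G that by (intro map_bounded_ops)
    fix x
    have "(\<Sum>i<n. \<Sum>j<n. cinner (T m (G i j) (x j)) (x i)) \<in> \<real>\<^sub>\<ge>\<^sub>0" for m
    proof -
      \<comment> \<open>The scalar matrix of \<open>G\<close> in the basis: the first component of
        an index is the block, the second the basis vector.\<close>
      define A where "A p q = cinner (G (fst p) (fst q) (e\<^sub>1 (snd q))) (e\<^sub>1 (snd p))" for p q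
      let ?I = "{..<n} \<times> {..<m}"
      have "(\<Sum>i<n. \<Sum>j<n. cinner (T m (G i j) (x j)) (x i))
          = (\<Sum>i<n. \<Sum>j<n. \<Sum>k<m. \<Sum>l<m. A (i, k) (j, l) * cinner (b k l (x j)) (x i))"
        by (simp add: T G A_def)
      also have "\<dots> \<in> \<real>\<^sub>\<ge>\<^sub>0"
      proof (rule schur_form_nonneg[OF b bpos])
        fix p q assume "p \<in> ?I" "q \<in> ?I"
        then have pq: "fst p < n" "fst q < n" by auto
        then have "G (fst q) (fst p) = cadjoint (G (fst p) (fst q))"
          using Gpos unfolding positive_mat_def selfadjoint_mat_def by blast
        then show "A p q = cnj (A q p)"
          unfolding A_def by (simp only: adj[OF G[OF pq]]) (rule cinner_commute)
      next
        fix c :: "nat \<times> nat \<Rightarrow> complex"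
        \<comment> \<open>Coefficients on pairs are read as vectors in the span of the first
          \<open>m\<close> basis vectors, one per block; the form of \<open>A\<close> at
          \<open>c\<close> is then that of \<open>G\<close> at \<open>u\<close>.\<close>
        define u where "u j = (\<Sum>l<m. c (j, l) *\<^sub>C e\<^sub>1 l)" for j
        have u: "cinner (G i j (u j)) (u i) = (\<Sum>k<m. \<Sum>l<m. A (i, k) (j, l) * c (j, l) * cnj (c (i, k)))"
          if "i < n" "j < n" for i j
          using dom_bounded_ops[OF G[OF that]]
          by (simp add: u_def A_def bounded_ops_def blinfun.sum_right cinner_sum_left cinner_sum_right
              cinner_scaleC_left cinner_scaleC_right sum_distrib_left mult_ac)
        have "(\<Sum>p\<in>?I. \<Sum>q\<in>?I. A p q * c q * cnj (c p))
            = (\<Sum>i<n. \<Sum>k<m. \<Sum>j<n. \<Sum>l<m. A (i, k) (j, l) * c (j, l) * cnj (c (i, k)))"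
          by (simp add: sum.cartesian_product')
        also have "\<dots> = (\<Sum>i<n. \<Sum>j<n. \<Sum>k<m. \<Sum>l<m. A (i, k) (j, l) * c (j, l) * cnj (c (i, k)))"
          by (simp only: sum.swap[of _ "{..<n}" "{..<m}"])
        also have "\<dots> = (\<Sum>i<n. \<Sum>j<n. cinner (G i j (u j)) (u i))"
          by (simp add: u)
        also have "\<dots> \<in> \<real>\<^sub>\<ge>\<^sub>0" using Gpos by (simp add: positive_mat_def)
        finally show "(\<Sum>p\<in>?I. \<Sum>q\<in>?I. A p q * c q * cnj (c p)) \<in> \<real>\<^sub>\<ge>\<^sub>0" .
      qed
      finally show ?thesis .
    qed
    moreover have "(\<lambda>m. \<Sum>i<n. \<Sum>j<n. cinner (T m (G i j) (x j)) (x i))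
        \<longlonglongrightarrow> (\<Sum>i<n. \<Sum>j<n. cinner (\<mu> (G i j) (x j)) (x i))"
      by (intro tendsto_sum lim G) auto
    ultimately show "(\<Sum>i<n. \<Sum>j<n. cinner (\<mu> (G i j) (x j)) (x i)) \<in> \<real>\<^sub>\<ge>\<^sub>0"
      by (intro Lim_in_closed_set[OF closed_nonneg_Reals_complex]) auto
  qed
  ultimately show ?thesis unfolding completely_positive_def by blast
qed

end

theorem theorem1:
  fixes e\<^sub>1 :: "nat \<Rightarrow> 'a::complex_hilbert"
    and e\<^sub>2 :: "nat \<Rightarrow> 'b::complex_hilbert"
    and \<Sigma>\<^sub>1 :: "('a \<Rightarrow>\<^sub>L 'a) set"
    and \<Sigma>\<^sub>2 :: "('b \<Rightarrow>\<^sub>L 'b) set"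
    and N\<^sub>1 :: "('a \<Rightarrow>\<^sub>L 'a) \<Rightarrow> real"
    and N\<^sub>2 :: "('b \<Rightarrow>\<^sub>L 'b) \<Rightarrow> real"
    and \<mu> :: "('a \<Rightarrow>\<^sub>L 'a) \<Rightarrow> ('b \<Rightarrow>\<^sub>L 'b)"
  assumes "orthonormal_basis e\<^sub>1"
    and "orthonormal_basis e\<^sub>2"
    and "operator_space \<Sigma>\<^sub>1 N\<^sub>1"
    and "operator_space \<Sigma>\<^sub>2 N\<^sub>2"
    and "bounded_clinear_between \<Sigma>\<^sub>1 N\<^sub>1 \<Sigma>\<^sub>2 N\<^sub>2 \<mu>"
    and "\<And>g. g \<in> \<Sigma>\<^sub>1 \<Longrightarrow> wot_tendsto (\<lambda>n. \<mu> (basis_proj e\<^sub>1 n o\<^sub>L g o\<^sub>L basis_proj e\<^sub>1 n)) (\<mu> g)"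
  shows "completely_positive \<Sigma>\<^sub>1 \<mu> \<longleftrightarrow> (\<forall>n. positive_mat n (L_mat e\<^sub>1 e\<^sub>2 \<mu> n))"
proof
  show "\<forall>n. positive_mat n (L_mat e\<^sub>1 e\<^sub>2 \<mu> n)" if "completely_positive \<Sigma>\<^sub>1 \<mu>"
    using completely_positive_imp_L_mat[OF assms(1-5) that] by blast
  show "completely_positive \<Sigma>\<^sub>1 \<mu>" if "\<forall>n. positive_mat n (L_mat e\<^sub>1 e\<^sub>2 \<mu> n)"
    by (rule L_mat_imp_completely_positive[OF assms(1-5) spec[OF that] assms(6)])
qed

end
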